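(* Let $D\subseteq\{0,1,\dots,d_{\max}\}$ be the set of delays, and let $A\in\mathbb{R}^{n\times n}$, $B\in\mathbb{R}^{n\times m}$. Consider the $n$-dimensional linear feedback system with switched delays $x(t+1)=Ax(t)+B\sum_{t-d_{\max}\le t'\le t:\ t'+\sigma(t')=t}v(t')$ with a delay-independent linear control of dimension $m$, $v(t)=K\,(x(t),v(t-d_{\max}),\dots,v(t-1))$, where $K\in\mathbb{R}^{m\times(n+md_{\max})}$. Any such system can be represented as a switching system with arbitrary switches among $|D|$ matrices, characterized by an $(n+2d_{\max}m)$-dimensional state space.
   Context: The control output $v(t)\in\mathbb{R}^m$ emitted at time $t$ reaches the plant with delay $\sigma(t)\in D$, i.e. it is applied at time $t+\sigma(t)$. If several outputs arrive at the same time they are added; if none arrives the input is $0$. The switching signal $\sigma$ is an arbitrary disturbance with values in $D$, and $d_{\max}$ is the maximum delay. The control is delay-independent: the controller does not know the past, current or future values of $\sigma$ and uses only $x(t)$ and its own past $d_{\max}$ outputs. A switching system with arbitrary switches among a finite set of matrices is a system whose state is multiplied at each time step by one of these matrices, with no constraint on the sequence of matrices chosen. *)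

theory Defs
  imports "Jordan_Normal_Form.Matrix"
begin

text \<open>
  Time is \<open>int\<close>: the dynamics runs for \<open>t \<ge> 0\<close>, and the delays and control outputs at the
  times \<open>-dmax, \<dots>, -1\<close> are free initial data. Values at earlier times are irrelevant.
\<close>

definition plant_input :: "nat \<Rightarrow> nat \<Rightarrow> (int \<Rightarrow> nat) \<Rightarrow> (int \<Rightarrow> real vec) \<Rightarrow> int \<Rightarrow> real vec" where
  "plant_input m dmax \<sigma> v t =
     finsum_vec TYPE(real) m v {t'. t - int dmax \<le> t' \<and> t' \<le> t \<and> t' + int (\<sigma> t') = t}"

definition stack_vecs :: "real vec list \<Rightarrow> real vec" where
  "stack_vecs vs = foldr (@\<^sub>v) vs (0\<^sub>v 0)"

text \<open>The vector \<open>(x(t), v(t - dmax), \<dots>, v(t - 1))\<close>.\<close>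

definition controller_data :: "nat \<Rightarrow> (int \<Rightarrow> real vec) \<Rightarrow> (int \<Rightarrow> real vec) \<Rightarrow> int \<Rightarrow> real vec" where
  "controller_data dmax x v t =
     x t @\<^sub>v stack_vecs (map (\<lambda>k. v (t - int dmax + int k)) [0..<dmax])"

text \<open>The list \<open>[\<sigma>(t - dmax), \<dots>, \<sigma>(t - 1)]\<close>.\<close>

definition past_delays :: "nat \<Rightarrow> (int \<Rightarrow> nat) \<Rightarrow> int \<Rightarrow> nat list" where
  "past_delays dmax \<sigma> t = map (\<lambda>k. \<sigma> (t - int dmax + int k)) [0..<dmax]"

definition feedback_trajectory ::
  "nat \<Rightarrow> nat \<Rightarrow> nat \<Rightarrow> nat set \<Rightarrow> real mat \<Rightarrow> real mat \<Rightarrow> real mat \<Rightarrow>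
   (int \<Rightarrow> nat) \<Rightarrow> (int \<Rightarrow> real vec) \<Rightarrow> (int \<Rightarrow> real vec) \<Rightarrow> bool" where
  "feedback_trajectory n m dmax D A B K \<sigma> x v \<longleftrightarrow>
     (\<forall>t \<ge> - int dmax. \<sigma> t \<in> D \<and> v t \<in> carrier_vec m) \<and>
     (\<forall>t \<ge> 0. x t \<in> carrier_vec n) \<and>
     (\<forall>t \<ge> 0. x (t + 1) = A *\<^sub>v x t + B *\<^sub>v plant_input m dmax \<sigma> v t) \<and>
     (\<forall>t \<ge> 0. v t = K *\<^sub>v controller_data dmax x v t)"

text \<open>
  Trajectories of the \<open>N\<close>-dimensional system with arbitrary switches among the matrices of the
  family \<open>(M i)\<^sub>i\<close> indexed by \<open>i \<in> I\<close>; \<open>s\<close> is the unconstrained sequence of chosen indices.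
\<close>

definition switching_trajectory ::
  "nat \<Rightarrow> 'i set \<Rightarrow> ('i \<Rightarrow> real mat) \<Rightarrow> (nat \<Rightarrow> 'i) \<Rightarrow> (nat \<Rightarrow> real vec) \<Rightarrow> bool" where
  "switching_trajectory N I M s z \<longleftrightarrow>
     z 0 \<in> carrier_vec N \<and> (\<forall>t. s t \<in> I \<and> z (Suc t) = M (s t) *\<^sub>v z t)"

text \<open>
  The switching system given by the matrices \<open>M d\<close>, \<open>d \<in> D\<close>, represents the feedback system.
  The switching state is a function of the past only: \<open>E h\<close> linearly embeds \<open>(x, past outputs)\<close>,
  where \<open>h\<close> lists the past \<open>dmax\<close> delays (which determine the outputs still in transit).
  The fixed readout \<open>R\<close>, which does not involve any delay, recovers \<open>(x, past outputs)\<close> from the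
  switching state. The last two conjuncts say that feedback trajectories become switching
  trajectories driven by the same signal, and that conversely every run of the switching system
  from an embedded initial state, under an arbitrary sequence of switches, arises in this way.
  The initial states are restricted because vectors outside the images of the \<open>E h\<close> need not
  correspond to any past of the feedback system.
\<close>

definition represented_by_switching ::
  "nat \<Rightarrow> nat \<Rightarrow> nat \<Rightarrow> nat set \<Rightarrow> real mat \<Rightarrow> real mat \<Rightarrow> real mat \<Rightarrow>
   nat \<Rightarrow> (nat \<Rightarrow> real mat) \<Rightarrow> bool" where
  "represented_by_switching n m dmax D A B K N M \<longleftrightarrow>
     (\<exists>(E :: nat list \<Rightarrow> real mat) (R :: real mat).
        R \<in> carrier_mat (n + m * dmax) N \<and>
        (\<forall>h. length h = dmax \<and> set h \<subseteq> D \<longrightarrow>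
           E h \<in> carrier_mat N (n + m * dmax) \<and> R * E h = 1\<^sub>m (n + m * dmax)) \<and>
        (\<forall>\<sigma> x v. feedback_trajectory n m dmax D A B K \<sigma> x v \<longrightarrow>
           switching_trajectory N D M (\<lambda>t. \<sigma> (int t))
             (\<lambda>t. E (past_delays dmax \<sigma> (int t)) *\<^sub>v controller_data dmax x v (int t))) \<and>
        (\<forall>h y s z. length h = dmax \<and> set h \<subseteq> D \<and> y \<in> carrier_vec (n + m * dmax) \<and>
           switching_trajectory N D M s z \<and> z 0 = E h *\<^sub>v y \<longrightarrow>
           (\<exists>\<sigma> x v. feedback_trajectory n m dmax D A B K \<sigma> x v \<and>
              past_delays dmax \<sigma> 0 = h \<and> controller_data dmax x v 0 = y \<and>
              (\<forall>t. \<sigma> (int t) = s t \<and>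
                z t = E (past_delays dmax \<sigma> (int t)) *\<^sub>v controller_data dmax x v (int t)))))"

end

theory Submission
  imports Defs
begin

text \<open>
  The state of the switching system at time \<open>t\<close> is \<open>(x(t), v(t - dmax), \<dots>, v(t - 1), p\<^sub>0, \<dots>)\<close>
  with \<open>dmax\<close> further blocks, where \<open>p\<^sub>k\<close> is the sum of the outputs already emitted that arrive at
  time \<open>t + k\<close>. Nothing emitted before \<open>t\<close> arrives later than \<open>t + dmax - 1\<close>, so \<open>k < dmax\<close>
  suffices. The step adds the new output \<open>v(t)\<close>, a function of \<open>x(t)\<close> and the past outputs, to
  \<open>p\<^bsub>\<sigma>(t)\<^esub>\<close>, feeds \<open>p\<^sub>0\<close> to the plant and shifts; it depends on the present delay only. In the
  converse direction, \<open>x\<close> and \<open>v\<close> are read off a given run.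
\<close>

subsection \<open>Maps given by matrices\<close>

text \<open>The switching matrices are never written out entry by entry. Step, embedding and readout
  are functions on vectors, and the closure rules below supply matrices for them. Agreement with the
  matrix is demanded on vectors of dimension \<open>N\<close> only.\<close>

definition matrix_map :: "nat \<Rightarrow> nat \<Rightarrow> (real vec \<Rightarrow> real vec) \<Rightarrow> bool" where
  "matrix_map N N' f \<longleftrightarrow> (\<exists>F \<in> carrier_mat N' N. \<forall>w \<in> carrier_vec N. f w = F *\<^sub>v w)"

lemma matrix_mapI:
  "F \<in> carrier_mat N' N \<Longrightarrow> (\<And>w. w \<in> carrier_vec N \<Longrightarrow> f w = F *\<^sub>v w) \<Longrightarrow> matrix_map N N' f"
  unfolding matrix_map_def by blast

lemma matrix_map_carrier:
  "matrix_map N N' f \<Longrightarrow> w \<in> carrier_vec N \<Longrightarrow> f w \<in> carrier_vec N'"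
  unfolding matrix_map_def by auto

lemma matrix_map_cong:
  "(\<And>w. w \<in> carrier_vec N \<Longrightarrow> f w = g w) \<Longrightarrow> matrix_map N N' f \<longleftrightarrow> matrix_map N N' g"
  unfolding matrix_map_def by simp

lemma matrix_map_id: "matrix_map N N (\<lambda>w. w)"
  by (rule matrix_mapI[of "1\<^sub>m N"]) auto

lemma matrix_map_zero: "matrix_map N N' (\<lambda>w. 0\<^sub>v N')"
  by (rule matrix_mapI[of "0\<^sub>m N' N"]) auto

lemma matrix_map_mult:
  assumes "G \<in> carrier_mat N'' N'" "matrix_map N N' f"
  shows "matrix_map N N'' (\<lambda>w. G *\<^sub>v f w)"
proof -
  from assms(2) obtain F where "F \<in> carrier_mat N' N" "\<And>w. w \<in> carrier_vec N \<Longrightarrow> f w = F *\<^sub>v w"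
    unfolding matrix_map_def by blast
  with assms(1) show ?thesis
    by (intro matrix_mapI[of "G * F"]) auto
qed

lemma matrix_map_add:
  assumes "matrix_map N N' f" "matrix_map N N' g"
  shows "matrix_map N N' (\<lambda>w. f w + g w)"
proof -
  from assms(1) obtain F where "F \<in> carrier_mat N' N" "\<And>w. w \<in> carrier_vec N \<Longrightarrow> f w = F *\<^sub>v w"
    unfolding matrix_map_def by blast
  moreover from assms(2) obtain G where
    "G \<in> carrier_mat N' N" "\<And>w. w \<in> carrier_vec N \<Longrightarrow> g w = G *\<^sub>v w"
    unfolding matrix_map_def by blast
  ultimately show ?thesis
    by (intro matrix_mapI[of "F + G"]) (auto simp: add_mult_distrib_mat_vec)
qed

lemma matrix_map_append:
  assumes "matrix_map N N1 f" "matrix_map N N2 g"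
  shows "matrix_map N (N1 + N2) (\<lambda>w. f w @\<^sub>v g w)"
proof -
  from assms(1) obtain F where "F \<in> carrier_mat N1 N" "\<And>w. w \<in> carrier_vec N \<Longrightarrow> f w = F *\<^sub>v w"
    unfolding matrix_map_def by blast
  moreover from assms(2) obtain G where
    "G \<in> carrier_mat N2 N" "\<And>w. w \<in> carrier_vec N \<Longrightarrow> g w = G *\<^sub>v w"
    unfolding matrix_map_def by blast
  ultimately show ?thesis
    by (intro matrix_mapI[of "F @\<^sub>r G"]) (auto simp: mat_mult_append)
qed

text \<open>Selecting coordinates of the value selects rows of the matrix. This covers both
  \<open>vec_first\<close> and \<open>block\<close>.\<close>

lemma matrix_map_coordinates:
  assumes "matrix_map N N' f" "\<And>i. i < k \<Longrightarrow> c i < N'"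
  shows "matrix_map N k (\<lambda>w. vec k (\<lambda>i. f w $ c i))"
proof -
  from assms(1) obtain F where F: "F \<in> carrier_mat N' N" "\<And>w. w \<in> carrier_vec N \<Longrightarrow> f w = F *\<^sub>v w"
    unfolding matrix_map_def by blast
  show ?thesis
  proof (rule matrix_mapI[of "mat k N (\<lambda>(i, j). F $$ (c i, j))"])
    fix w :: "real vec" assume "w \<in> carrier_vec N"
    with F assms(2) show "vec k (\<lambda>i. f w $ c i) = mat k N (\<lambda>(i, j). F $$ (c i, j)) *\<^sub>v w"
      by (intro eq_vecI) (auto simp: scalar_prod_def)
  qed simp
qed

lemma matrix_map_finsum:
  assumes "finite J" "\<And>j. j \<in> J \<Longrightarrow> matrix_map N N' (\<lambda>w. f w j)"
  shows "matrix_map N N' (\<lambda>w. finsum_vec TYPE(real) N' (f w) J)"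
  using assms
proof (induction J rule: finite_induct)
  case empty
  then show ?case by (simp add: finsum_vec_empty matrix_map_zero)
next
  case (insert j J)
  \<comment> \<open>Splitting off a summand needs all summands in the carrier, which is known only
    for \<open>w\<close> of dimension \<open>N\<close>; hence the passage through
    \<open>matrix_map_cong\<close>.\<close>
  have "finsum_vec TYPE(real) N' (f w) (insert j J) = f w j + finsum_vec TYPE(real) N' (f w) J"
    if "w \<in> carrier_vec N" for w
    using insert.hyps matrix_map_carrier[OF insert.prems that] by (intro finsum_vec_insert) auto
  then have "matrix_map N N' (\<lambda>w. finsum_vec TYPE(real) N' (f w) (insert j J)) \<longleftrightarrow>
      matrix_map N N' (\<lambda>w. f w j + finsum_vec TYPE(real) N' (f w) J)"
    by (rule matrix_map_cong)
  with insert show ?case by (simp add: matrix_map_add)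
qed

lemma mat_eq_one:
  assumes "F \<in> carrier_mat N N" "\<And>w :: real vec. w \<in> carrier_vec N \<Longrightarrow> F *\<^sub>v w = w"
  shows "F = 1\<^sub>m N"
proof (rule eq_matI)
  fix i j assume ij: "i < dim_row (1\<^sub>m N :: real mat)" "j < dim_col (1\<^sub>m N :: real mat)"
  then have "F $$ (i, j) = (F *\<^sub>v unit_vec N j) $ i"
    using assms(1) by auto
  with ij show "F $$ (i, j) = 1\<^sub>m N $$ (i, j)"
    by (simp add: assms(2))
qed (use assms(1) in auto)

subsection \<open>Stacked blocks\<close>

text \<open>The offset \<open>n\<close> is a parameter because the same reader serves twice: past
  outputs start after \<open>n\<close> coordinates, transit sums after
  \<open>n + m * dmax\<close>.\<close>

definition block :: "nat \<Rightarrow> nat \<Rightarrow> nat \<Rightarrow> real vec \<Rightarrow> real vec" where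
  "block m n k w = vec m (\<lambda>i. w $ (n + (m * k + i)))"

lemma block_carrier [simp]: "block m n k w \<in> carrier_vec m"
  by (simp add: block_def)

lemma block_index_less:
  fixes m :: nat
  assumes "k < L" "i < m"
  shows "m * k + i < m * L"
proof -
  have "m * k + i < m * Suc k" using assms(2) by simp
  also have "\<dots> \<le> m * L" using assms(1) by (intro mult_le_mono) auto
  finally show ?thesis .
qed

lemma stack_vecs_Nil [simp]: "stack_vecs [] = 0\<^sub>v 0"
  and stack_vecs_Cons [simp]: "stack_vecs (v # vs) = v @\<^sub>v stack_vecs vs"
  by (simp_all add: stack_vecs_def)

lemma stack_vecs_carrier:
  "(\<And>v. v \<in> set vs \<Longrightarrow> v \<in> carrier_vec m) \<Longrightarrow> stack_vecs vs \<in> carrier_vec (m * length vs)"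
  by (induction vs) auto

lemma stack_vecs_index:
  assumes "\<And>v. v \<in> set vs \<Longrightarrow> v \<in> carrier_vec m" "k < length vs" "i < m"
  shows "stack_vecs vs $ (m * k + i) = vs ! k $ i"
  using assms
proof (induction vs arbitrary: k)
  case (Cons v vs)
  have dim: "dim_vec v = m" "dim_vec (stack_vecs vs) = m * length vs"
    using Cons.prems(1) stack_vecs_carrier[of vs m] by auto
  show ?case
  proof (cases k)
    case 0
    with dim Cons.prems(3) show ?thesis by simp
  next
    case (Suc k')
    then have "stack_vecs vs $ (m * k' + i) = vs ! k' $ i"
      using Cons.prems by (intro Cons.IH) auto
    with Suc dim Cons.prems(2,3) block_index_less[of k' "length vs" i m] show ?thesis
      by (simp add: add.assoc)
  qed
qed simp

lemma stack_blocks_carrier: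
  "(\<And>k. k < L \<Longrightarrow> f k \<in> carrier_vec m) \<Longrightarrow> stack_vecs (map f [0..<L]) \<in> carrier_vec (m * L)"
  using stack_vecs_carrier[of "map f [0..<L]" m] by fastforce

lemma block_append_stack:
  assumes "x \<in> carrier_vec n" "\<And>k. k < L \<Longrightarrow> f k \<in> carrier_vec m" "k < L"
  shows "block m n k (x @\<^sub>v stack_vecs (map f [0..<L])) = f k"
proof (rule eq_vecI)
  have S: "stack_vecs (map f [0..<L]) \<in> carrier_vec (m * L)"
    by (rule stack_blocks_carrier) (rule assms(2))
  fix i assume "i < dim_vec (f k)"
  then have i: "i < m" using carrier_vecD[OF assms(2)[OF assms(3)]] by simp
  have "stack_vecs (map f [0..<L]) $ (m * k + i) = map f [0..<L] ! k $ i"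
    using assms(2,3) i by (intro stack_vecs_index) auto
  then show "block m n k (x @\<^sub>v stack_vecs (map f [0..<L])) $ i = f k $ i"
    using assms(1,3) S i block_index_less[of k L i m] by (simp add: block_def)
qed (use carrier_vecD[OF assms(2)[OF assms(3)]] in \<open>simp add: block_def\<close>)

lemma vec_first_append:
  assumes "x \<in> carrier_vec n"
  shows "vec_first (x @\<^sub>v y) n = x"
  using assms by (intro eq_vecI) (auto simp: vec_first_def)

text \<open>Makes an arbitrary vector of the right dimension usable as initial data: its blocks
  serve as the past outputs when a switching run is turned into a feedback trajectory.\<close>

lemma append_stack_blocks:
  assumes "y \<in> carrier_vec (n + m * L)"
  shows "vec_first y n @\<^sub>v stack_vecs (map (\<lambda>k. block m n k y) [0..<L]) = y"
proof (rule eq_vecI)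
  let ?s = "stack_vecs (map (\<lambda>k. block m n k y) [0..<L])"
  have S: "?s \<in> carrier_vec (m * L)" by (rule stack_blocks_carrier) simp
  then show "dim_vec (vec_first y n @\<^sub>v ?s) = dim_vec y" using assms by simp
  fix i assume "i < dim_vec y"
  then have i: "i < n + m * L" using assms by simp
  show "(vec_first y n @\<^sub>v ?s) $ i = y $ i"
  proof (cases "i < n")
    case True
    then show ?thesis using S by (simp add: vec_first_def)
  next
    case False
    define k r where "k = (i - n) div m" and "r = (i - n) mod m"
    \<comment> \<open>A position \<open>i\<close> with n \<le> i < n + m L exists only for positive
      \<open>m\<close>; this bounds the remainder \<open>r\<close> by \<open>m\<close>.\<close>
    have m: "m > 0" using i False by (cases m) auto
    then have kr: "i = n + (m * k + r)" "r < m" using False by (auto simp: k_def r_def)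
    have k: "k < L"
      unfolding k_def using i False m by (intro less_mult_imp_div_less) (simp add: mult.commute)
    have "?s $ (m * k + r) = block m n k y $ r"
      using k kr(2) stack_vecs_index[of "map (\<lambda>k. block m n k y) [0..<L]" m k r] by fastforce
    then show ?thesis using S i kr by (simp add: block_def)
  qed
qed

lemma matrix_map_vec_first:
  "matrix_map N N' f \<Longrightarrow> k \<le> N' \<Longrightarrow> matrix_map N k (\<lambda>w. vec_first (f w) k)"
  unfolding vec_first_def by (erule matrix_map_coordinates[where c = "\<lambda>i. i"]) simp

lemma matrix_map_block:
  assumes "matrix_map N (n + m * L) f" "k < L"
  shows "matrix_map N m (\<lambda>w. block m n k (f w))"
  unfolding block_def using assms(1)
  by (rule matrix_map_coordinates) (simp add: block_index_less assms(2))

lemma matrix_map_stack: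
  assumes "\<And>k. k < L \<Longrightarrow> matrix_map N m (\<lambda>w. f w k)"
  shows "matrix_map N (m * L) (\<lambda>w. stack_vecs (map (f w) [0..<L]))"
proof -
  \<comment> \<open>Generalised from \<open>[0..<L]\<close> to any list of indices below
    \<open>L\<close>, since the induction removes the head of the list.\<close>
  have "matrix_map N (m * length ks) (\<lambda>w. stack_vecs (map (f w) ks))" if "set ks \<subseteq> {..<L}" for ks
    using that
  proof (induction ks)
    case Nil
    then show ?case using matrix_map_zero[of N 0] by simp
  next
    case (Cons k ks)
    then show ?case using matrix_map_append[OF assms[of k] Cons.IH] by simp
  qed
  from this[of "[0..<L]"] show ?thesis by fastforce
qed

subsection \<open>Outputs in transit\<close>

text \<open>The block p_k of the overview at time \<open>t\<close>. The strict bound t' < t leaves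
  out the output emitted at \<open>t\<close> itself.\<close>

definition in_transit :: "nat \<Rightarrow> nat \<Rightarrow> (int \<Rightarrow> nat) \<Rightarrow> (int \<Rightarrow> real vec) \<Rightarrow> int \<Rightarrow> nat \<Rightarrow> real vec" where
  "in_transit m dmax \<sigma> v t k =
     finsum_vec TYPE(real) m v {t'. t - int dmax \<le> t' \<and> t' < t \<and> t' + int (\<sigma> t') = t + int k}"

text \<open>The same sum computed from the stored history alone. Index \<open>j\<close> stands for
  time t - dmax + j, so arrival at t + k means j + h_j = k + dmax, and \<open>t\<close> drops
  out.\<close>

definition in_transit_of :: "nat \<Rightarrow> nat \<Rightarrow> nat \<Rightarrow> nat list \<Rightarrow> real vec \<Rightarrow> nat \<Rightarrow> real vec" where
  "in_transit_of n m dmax h y k =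
     finsum_vec TYPE(real) m (\<lambda>j. block m n j y) {j. j < dmax \<and> j + h ! j = k + dmax}"

text \<open>\<open>finsum_vec\<close> is \<open>finprod\<close> in the additive monoid of vectors,
  from which this rule and the next are transferred.\<close>

lemma finsum_vec_reindex:
  "f \<in> g ` J \<rightarrow> carrier_vec m \<Longrightarrow> inj_on g J \<Longrightarrow>
    finsum_vec TYPE(real) m f (g ` J) = finsum_vec TYPE(real) m (\<lambda>j. f (g j)) J"
  using comm_monoid.finprod_reindex[OF comm_monoid_vec, of f g J m]
  by (simp add: finsum_vec_def monoid_vec_simps)

lemma finsum_vec_cong:
  "J = J' \<Longrightarrow> g \<in> J' \<rightarrow> carrier_vec m \<Longrightarrow> (\<And>j. j \<in> J' \<Longrightarrow> f j = g j) \<Longrightarrow>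
    finsum_vec TYPE(real) m f J = finsum_vec TYPE(real) m g J'"
  using comm_monoid.finprod_cong'[OF comm_monoid_vec, of J J' g m f]
  by (simp add: finsum_vec_def monoid_vec_simps)

text \<open>Contains bounds and dimensions but no dynamics. It can therefore be interpreted for
  signals read off a switching run before they are known to form a feedback trajectory.\<close>

locale delayed_outputs =
  fixes m dmax :: nat and \<sigma> :: "int \<Rightarrow> nat" and v :: "int \<Rightarrow> real vec"
  assumes delay_le: "- int dmax \<le> t \<Longrightarrow> \<sigma> t \<le> dmax"
    and output_carrier: "- int dmax \<le> t \<Longrightarrow> v t \<in> carrier_vec m"
begin

lemma in_transit_carrier:
  "0 \<le> t \<Longrightarrow> in_transit m dmax \<sigma> v t k \<in> carrier_vec m"
  unfolding in_transit_def by (intro finsum_vec_closed) (auto intro!: output_carrier)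

text \<open>Only the output emitted at \<open>t\<close> is new, and it arrives at t + k exactly when
  its delay is \<open>k\<close>. The case k = 0 gives the plant input, successors give the shift of
  the transit blocks.\<close>

lemma arrivals_split:
  assumes "0 \<le> t"
  shows "finsum_vec TYPE(real) m v
      {t'. t - int dmax \<le> t' \<and> t' \<le> t \<and> t' + int (\<sigma> t') = t + int k} =
    in_transit m dmax \<sigma> v t k + (if \<sigma> t = k then v t else 0\<^sub>v m)"
    (is "finsum_vec _ _ _ ?S = _")
proof -
  let ?T = "{t'. t - int dmax \<le> t' \<and> t' < t \<and> t' + int (\<sigma> t') = t + int k}"
  have fin: "finite ?T" by (rule finite_subset[of _ "{t - int dmax..t}"]) auto
  have v: "v \<in> ?T \<rightarrow> carrier_vec m" "v t \<in> carrier_vec m"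
    using assms by (auto intro!: output_carrier)
  show ?thesis
  proof (cases "\<sigma> t = k")
    case True
    then have "?S = insert t ?T" by auto
    then have "finsum_vec TYPE(real) m v ?S = v t + in_transit m dmax \<sigma> v t k"
      using finsum_vec_insert[OF fin _ v] by (simp add: in_transit_def)
    then show ?thesis
      using True v(2) in_transit_carrier[OF assms, of k] by (simp add: comm_add_vec[of _ m])
  next
    case False
    then have "?S = ?T" by (auto simp: order.order_iff_strict)
    then show ?thesis
      using False in_transit_carrier[OF assms, of k] by (simp add: in_transit_def)
  qed
qed

lemma plant_input_eq:
  "0 \<le> t \<Longrightarrow>
    plant_input m dmax \<sigma> v t = in_transit m dmax \<sigma> v t 0 + (if \<sigma> t = 0 then v t else 0\<^sub>v m)"
  using arrivals_split[of t 0] by (simp add: plant_input_def)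

lemma in_transit_step:
  assumes "0 \<le> t"
  shows "in_transit m dmax \<sigma> v (t + 1) k =
    in_transit m dmax \<sigma> v t (Suc k) + (if \<sigma> t = Suc k then v t else 0\<^sub>v m)"
proof -
  have "{t'. t + 1 - int dmax \<le> t' \<and> t' < t + 1 \<and> t' + int (\<sigma> t') = t + 1 + int k} =
      {t'. t - int dmax \<le> t' \<and> t' \<le> t \<and> t' + int (\<sigma> t') = t + int (Suc k)}" (is "?S = ?T")
  proof
    show "?T \<subseteq> ?S"
    proof
      \<comment> \<open>The window loses the emission time t - dmax: an output from then has arrived
        by time \<open>t\<close>, so it cannot arrive at t + 1 + k.\<close>
      fix t' assume t': "t' \<in> ?T"
      then have "\<sigma> t' \<le> dmax" using assms by (intro delay_le) auto
      with t' show "t' \<in> ?S" by auto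
    qed
  qed auto
  then show ?thesis
    using arrivals_split[OF assms, of "Suc k"] by (simp add: in_transit_def)
qed

text \<open>An output emitted before \<open>t\<close> with delay at most \<open>dmax\<close> arrives
  before t + dmax. This justifies the default zero in \<open>arriving\<close>.\<close>

lemma in_transit_dmax:
  assumes "0 \<le> t"
  shows "in_transit m dmax \<sigma> v t dmax = 0\<^sub>v m"
proof -
  have "t' + int (\<sigma> t') \<noteq> t + int dmax" if "t - int dmax \<le> t'" "t' < t" for t'
    using that assms delay_le[of t'] by linarith
  then have "{t'. t - int dmax \<le> t' \<and> t' < t \<and> t' + int (\<sigma> t') = t + int dmax} = {}"
    by auto
  then show ?thesis by (simp only: in_transit_def finsum_vec_empty)
qed

lemma block_controller_data:
  assumes "0 \<le> t" "x t \<in> carrier_vec n" "k < dmax"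
  shows "block m n k (controller_data dmax x v t) = v (t - int dmax + int k)"
  unfolding controller_data_def using assms
  by (intro block_append_stack) (auto intro!: output_carrier)

lemma controller_data_carrier:
  "0 \<le> t \<Longrightarrow> x t \<in> carrier_vec n \<Longrightarrow> controller_data dmax x v t \<in> carrier_vec (n + m * dmax)"
  unfolding controller_data_def
  by (intro append_carrier_vec stack_blocks_carrier) (auto intro!: output_carrier)

lemma in_transit_of_past:
  assumes "0 \<le> t" "x t \<in> carrier_vec n"
  shows "in_transit_of n m dmax (past_delays dmax \<sigma> t) (controller_data dmax x v t) k =
    in_transit m dmax \<sigma> v t k"
proof -
  let ?g = "\<lambda>j. t - int dmax + int j"
  let ?J = "{j. j < dmax \<and> j + \<sigma> (?g j) = k + dmax}"
  have img: "{t'. t - int dmax \<le> t' \<and> t' < t \<and> t' + int (\<sigma> t') = t + int k} = ?g ` ?J" (is "?T = _")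
  proof
    show "?T \<subseteq> ?g ` ?J"
    proof
      \<comment> \<open>The index of t' is t' - t + dmax: nonnegative by the lower end of the
        window, and below \<open>dmax\<close> because t' < t.\<close>
      fix t' assume "t' \<in> ?T"
      then have "t' = ?g (nat (t' - t + int dmax))" "nat (t' - t + int dmax) \<in> ?J"
        by auto
      then show "t' \<in> ?g ` ?J" by blast
    qed
  qed auto
  have v: "v \<in> ?g ` ?J \<rightarrow> carrier_vec m"
    using assms(1) by (auto intro!: output_carrier)
  have "in_transit m dmax \<sigma> v t k = finsum_vec TYPE(real) m (\<lambda>j. v (?g j)) ?J"
    unfolding in_transit_def img using v by (rule finsum_vec_reindex) (auto simp: inj_on_def)
  also have "\<dots> = in_transit_of n m dmax (past_delays dmax \<sigma> t) (controller_data dmax x v t) k"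
    unfolding in_transit_of_def
    using v by (intro finsum_vec_cong)
      (auto simp: past_delays_def block_controller_data[where x = x, OF assms])
  finally show ?thesis by simp
qed

end

subsection \<open>The switching system\<close>

definition switching_state :: "nat \<Rightarrow> nat \<Rightarrow> nat \<Rightarrow> nat list \<Rightarrow> real vec \<Rightarrow> real vec" where
  "switching_state n m dmax h y = y @\<^sub>v stack_vecs (map (in_transit_of n m dmax h y) [0..<dmax])"

text \<open>Mirrors the right-hand side of \<open>arrivals_split\<close> on a switching state. The
  index \<open>dmax\<close>, for which no block is stored, occurs after the shift, and also for the
  plant input when \<open>dmax\<close> is 0.\<close>

definition arriving :: "nat \<Rightarrow> nat \<Rightarrow> nat \<Rightarrow> real mat \<Rightarrow> nat \<Rightarrow> real vec \<Rightarrow> nat \<Rightarrow> real vec" where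
  "arriving n m dmax K d z k =
     (if k < dmax then block m (n + m * dmax) k z else 0\<^sub>v m) +
     (if d = k then K *\<^sub>v vec_first z (n + m * dmax) else 0\<^sub>v m)"

text \<open>The delay \<open>d\<close> enters only through \<open>arriving\<close>. In the output
  memory, the last block k = dmax - 1 has no successor and receives the new output.\<close>

definition switching_step ::
  "nat \<Rightarrow> nat \<Rightarrow> nat \<Rightarrow> real mat \<Rightarrow> real mat \<Rightarrow> real mat \<Rightarrow> nat \<Rightarrow> real vec \<Rightarrow> real vec" where
  "switching_step n m dmax A B K d z =
     ((A *\<^sub>v vec_first z n + B *\<^sub>v arriving n m dmax K d z 0) @\<^sub>v
      stack_vecs (map (\<lambda>k. if Suc k < dmax then block m n (Suc k) (vec_first z (n + m * dmax))
                           else K *\<^sub>v vec_first z (n + m * dmax)) [0..<dmax])) @\<^sub>v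
     stack_vecs (map (\<lambda>k. arriving n m dmax K d z (Suc k)) [0..<dmax])"

lemma matrix_map_switching_state:
  "matrix_map (n + m * dmax) (n + m * dmax + m * dmax) (switching_state n m dmax h)"
  unfolding switching_state_def in_transit_of_def
  by (intro matrix_map_append matrix_map_id matrix_map_stack matrix_map_finsum matrix_map_block)
    (auto intro: matrix_map_id)

lemma matrix_map_arriving:
  assumes "K \<in> carrier_mat m (n + m * dmax)"
  shows "matrix_map (n + m * dmax + m * dmax) m (\<lambda>z. arriving n m dmax K d z k)"
proof -
  let ?N = "n + m * dmax + m * dmax"
  have "matrix_map ?N m (\<lambda>z. if k < dmax then block m (n + m * dmax) k z else 0\<^sub>v m)"
    by (cases "k < dmax") (auto intro: matrix_map_block matrix_map_id matrix_map_zero)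
  moreover have "matrix_map ?N m (\<lambda>z. if d = k then K *\<^sub>v vec_first z (n + m * dmax) else 0\<^sub>v m)"
    by (cases "d = k")
      (auto intro!: matrix_map_mult[OF assms] matrix_map_vec_first[OF matrix_map_id] matrix_map_zero)
  ultimately show ?thesis unfolding arriving_def by (rule matrix_map_add)
qed

lemma matrix_map_switching_step:
  assumes "A \<in> carrier_mat n n" "B \<in> carrier_mat n m" "K \<in> carrier_mat m (n + m * dmax)"
  shows "matrix_map (n + m * dmax + m * dmax) (n + m * dmax + m * dmax)
    (switching_step n m dmax A B K d)"
proof -
  let ?N = "n + m * dmax + m * dmax"
  have y: "matrix_map ?N (n + m * dmax) (\<lambda>z. vec_first z (n + m * dmax))"
    by (rule matrix_map_vec_first[OF matrix_map_id]) simp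
  have "matrix_map ?N m (\<lambda>z. if Suc k < dmax then block m n (Suc k) (vec_first z (n + m * dmax))
          else K *\<^sub>v vec_first z (n + m * dmax))" for k
    by (cases "Suc k < dmax") (auto intro: matrix_map_block y matrix_map_mult[OF assms(3)])
  moreover have "matrix_map ?N n (\<lambda>z. vec_first z n)"
    by (rule matrix_map_vec_first[OF matrix_map_id]) simp
  ultimately show ?thesis
    unfolding switching_step_def
    by (intro matrix_map_append matrix_map_stack matrix_map_add matrix_map_mult[OF assms(1)]
        matrix_map_mult[OF assms(2)] matrix_map_arriving[OF assms(3)]) auto
qed

lemma vec_first_switching_state:
  "y \<in> carrier_vec (n + m * dmax) \<Longrightarrow> vec_first (switching_state n m dmax h y) (n + m * dmax) = y"
  unfolding switching_state_def by (rule vec_first_append)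

lemma vec_first_switching_state_plant:
  "y \<in> carrier_vec (n + m * dmax) \<Longrightarrow> vec_first (switching_state n m dmax h y) n = vec_first y n"
  by (intro eq_vecI) (auto simp: switching_state_def vec_first_def)

context delayed_outputs
begin

text \<open>The control law is assumed at the single time \<open>t\<close> only, so that the lemma
  can be used inside an induction over time.\<close>

lemma arriving_switching_state:
  assumes "0 \<le> t" "x t \<in> carrier_vec n" "v t = K *\<^sub>v controller_data dmax x v t" "k \<le> dmax"
  shows "arriving n m dmax K (\<sigma> t)
      (switching_state n m dmax (past_delays dmax \<sigma> t) (controller_data dmax x v t)) k =
    in_transit m dmax \<sigma> v t k + (if \<sigma> t = k then v t else 0\<^sub>v m)"
proof -
  let ?h = "past_delays dmax \<sigma> t" and ?y = "controller_data dmax x v t"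
  note y = controller_data_carrier[where x = x, OF assms(1,2)]
  note tr = in_transit_of_past[where x = x, OF assms(1,2)]
  have "block m (n + m * dmax) k (switching_state n m dmax ?h ?y) = in_transit m dmax \<sigma> v t k" if "k < dmax"
    unfolding switching_state_def using y that in_transit_carrier[OF assms(1)]
    by (subst block_append_stack) (auto simp: tr)
  then show ?thesis
    using assms(3,4) in_transit_dmax[OF assms(1)] by (auto simp: arriving_def vec_first_switching_state[OF y])
qed

text \<open>The plant equation is not assumed: its right-hand side stands where x(t + 1) is
  expected. Forward, the equation turns the result into the next embedded state; backward, the
  equation is read off from it.\<close>

lemma switching_step_switching_state:
  assumes "0 \<le> t" "x t \<in> carrier_vec n" "v t = K *\<^sub>v controller_data dmax x v t"
  shows "switching_step n m dmax A B K (\<sigma> t)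
      (switching_state n m dmax (past_delays dmax \<sigma> t) (controller_data dmax x v t)) =
    ((A *\<^sub>v x t + B *\<^sub>v plant_input m dmax \<sigma> v t) @\<^sub>v
      stack_vecs (map (\<lambda>k. v (t + 1 - int dmax + int k)) [0..<dmax])) @\<^sub>v
    stack_vecs (map (in_transit m dmax \<sigma> v (t + 1)) [0..<dmax])"
proof -
  let ?y = "controller_data dmax x v t"
  let ?z = "switching_state n m dmax (past_delays dmax \<sigma> t) ?y"
  note y = controller_data_carrier[where x = x, OF assms(1,2)]
  have x: "vec_first ?z n = x t"
    unfolding vec_first_switching_state_plant[OF y]
    unfolding controller_data_def using assms(2) by (rule vec_first_append)
  have p: "arriving n m dmax K (\<sigma> t) ?z 0 = plant_input m dmax \<sigma> v t"
    using arriving_switching_state[OF assms, of 0] plant_input_eq[OF assms(1)] by simp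
  have q: "arriving n m dmax K (\<sigma> t) ?z (Suc k) = in_transit m dmax \<sigma> v (t + 1) k" if "k < dmax" for k
    using arriving_switching_state[OF assms, of "Suc k"] in_transit_step[OF assms(1)] that by simp
  have u: "(if Suc k < dmax then block m n (Suc k) (vec_first ?z (n + m * dmax))
        else K *\<^sub>v vec_first ?z (n + m * dmax)) = v (t + 1 - int dmax + int k)" if "k < dmax" for k
  proof (cases "Suc k < dmax")
    case True
    have "t - int dmax + int (Suc k) = t + 1 - int dmax + int k" by simp
    with True show ?thesis
      using block_controller_data[where x = x and k = "Suc k", OF assms(1,2)]
      by (simp only: vec_first_switching_state[OF y] if_True)
  next
    case False
    \<comment> \<open>Here k = dmax - 1, so the block belongs to time \<open>t\<close> and is the
      fresh output.\<close>
    then have "t + 1 - int dmax + int k = t" using that by simp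
    with False show ?thesis by (simp only: vec_first_switching_state[OF y] assms(3) if_False)
  qed
  have "map (\<lambda>k. arriving n m dmax K (\<sigma> t) ?z (Suc k)) [0..<dmax] =
      map (in_transit m dmax \<sigma> v (t + 1)) [0..<dmax]"
    using q by simp
  moreover have "map (\<lambda>k. if Suc k < dmax then block m n (Suc k) (vec_first ?z (n + m * dmax))
        else K *\<^sub>v vec_first ?z (n + m * dmax)) [0..<dmax] =
      map (\<lambda>k. v (t + 1 - int dmax + int k)) [0..<dmax]"
    using u by simp
  ultimately show ?thesis
    unfolding switching_step_def x p by (simp only:)
qed

lemma switching_state_past:
  assumes "0 \<le> t" "x t \<in> carrier_vec n"
  shows "switching_state n m dmax (past_delays dmax \<sigma> t) (controller_data dmax x v t) =
    (x t @\<^sub>v stack_vecs (map (\<lambda>k. v (t - int dmax + int k)) [0..<dmax])) @\<^sub>v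
    stack_vecs (map (in_transit m dmax \<sigma> v t) [0..<dmax])"
proof -
  have "in_transit_of n m dmax (past_delays dmax \<sigma> t) (controller_data dmax x v t) =
      in_transit m dmax \<sigma> v t"
    by (rule ext) (rule in_transit_of_past[where x = x, OF assms])
  then show ?thesis by (simp add: switching_state_def controller_data_def)
qed

end

section \<open>Correspondence between feedback trajectories and switching runs\<close>

lemma feedback_trajectory_imp_delayed_outputs:
  assumes "feedback_trajectory n m dmax D A B K \<sigma> x v" "D \<subseteq> {0..dmax}"
  shows "delayed_outputs m dmax \<sigma> v"
  using assms unfolding feedback_trajectory_def by unfold_locales fastforce+

lemma feedback_trajectory_step:
  assumes "feedback_trajectory n m dmax D A B K \<sigma> x v" "D \<subseteq> {0..dmax}" "0 \<le> t"
  shows "switching_step n m dmax A B K (\<sigma> t)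
      (switching_state n m dmax (past_delays dmax \<sigma> t) (controller_data dmax x v t)) =
    switching_state n m dmax (past_delays dmax \<sigma> (t + 1)) (controller_data dmax x v (t + 1))"
proof -
  interpret delayed_outputs m dmax \<sigma> v
    using assms(1,2) by (rule feedback_trajectory_imp_delayed_outputs)
  have t: "0 \<le> t + 1" using assms(3) by simp
  have tr: "x t \<in> carrier_vec n" "x (t + 1) \<in> carrier_vec n" "v t = K *\<^sub>v controller_data dmax x v t"
    "x (t + 1) = A *\<^sub>v x t + B *\<^sub>v plant_input m dmax \<sigma> v t"
    using assms(1,3) t unfolding feedback_trajectory_def by blast+
  show ?thesis
    by (simp only: switching_step_switching_state[where x = x, OF assms(3) tr(1,3)]
        switching_state_past[where x = x, OF t tr(2)] tr(4))
qed

lemma switching_run_realized: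
  assumes "D \<subseteq> {0..dmax}" "A \<in> carrier_mat n n" "B \<in> carrier_mat n m"
    and K: "K \<in> carrier_mat m (n + m * dmax)"
    and h: "length h = dmax" "set h \<subseteq> D" and y: "y \<in> carrier_vec (n + m * dmax)"
    and s: "\<And>t. s t \<in> D"
    and z0: "z 0 = switching_state n m dmax h y"
    and z_step: "\<And>t. z (Suc t) = switching_step n m dmax A B K (s t) (z t)"
  obtains \<sigma> x v where "feedback_trajectory n m dmax D A B K \<sigma> x v"
    and "past_delays dmax \<sigma> 0 = h" and "controller_data dmax x v 0 = y"
    and "\<And>t. \<sigma> (int t) = s t"
    and "\<And>t. z t = switching_state n m dmax (past_delays dmax \<sigma> (int t)) (controller_data dmax x v (int t))"
proof -
  \<comment> \<open>Negative times are filled from \<open>h\<close> and \<open>y\<close>, entry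
    \<open>j\<close> belonging to time j - dmax; from time 0 on, the run supplies all
    values.\<close>
  define \<sigma> where "\<sigma> t = (if t < 0 then h ! nat (t + int dmax) else s (nat t))" for t
  define x where "x t = vec_first (z (nat t)) n" for t
  define v where "v t = (if t < 0 then block m n (nat (t + int dmax)) y
      else K *\<^sub>v vec_first (z (nat t)) (n + m * dmax))" for t
  have \<sigma>_D: "\<sigma> t \<in> D" if "- int dmax \<le> t" for t
    using that h s unfolding \<sigma>_def by (auto intro!: subsetD[OF h(2)])
  have v_carrier: "v t \<in> carrier_vec m" for t
    using K by (auto simp: v_def intro!: mult_mat_vec_carrier)
  interpret delayed_outputs m dmax \<sigma> v
    using \<sigma>_D assms(1) v_carrier by unfold_locales force+
  have \<sigma>_s: "\<sigma> (int t) = s t" for t by (simp add: \<sigma>_def)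
  have x_carrier: "x t \<in> carrier_vec n" for t by (simp add: x_def)
  have h0: "past_delays dmax \<sigma> 0 = h"
    using h(1) by (intro nth_equalityI) (auto simp: past_delays_def \<sigma>_def)
  have blocks: "map (\<lambda>k. v (0 - int dmax + int k)) [0..<dmax] = map (\<lambda>k. block m n k y) [0..<dmax]"
    by (auto simp: v_def)
  have "x 0 = vec_first y n"
    by (simp add: x_def z0 vec_first_switching_state_plant[OF y])
  then have y0: "controller_data dmax x v 0 = y"
    unfolding controller_data_def blocks using append_stack_blocks[OF y] by simp
  \<comment> \<open>This and the next two facts are conditional on the invariant at time
    \<open>t\<close>. The induction for \<open>z_eq\<close> carries the invariant on, and only then
    do they hold at every time.\<close>
  have v_eq: "v (int t) = K *\<^sub>v controller_data dmax x v (int t)"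
    if "z t = switching_state n m dmax (past_delays dmax \<sigma> (int t)) (controller_data dmax x v (int t))" for t
    using vec_first_switching_state[OF controller_data_carrier[where x = x, OF _ x_carrier]]
    by (simp add: v_def that)
  have step: "z (Suc t) = ((A *\<^sub>v x (int t) + B *\<^sub>v plant_input m dmax \<sigma> v (int t)) @\<^sub>v
      stack_vecs (map (\<lambda>k. v (int t + 1 - int dmax + int k)) [0..<dmax])) @\<^sub>v
    stack_vecs (map (in_transit m dmax \<sigma> v (int t + 1)) [0..<dmax])"
    if "z t = switching_state n m dmax (past_delays dmax \<sigma> (int t)) (controller_data dmax x v (int t))" for t
    using switching_step_switching_state[where x = x and t = "int t" and n = n,
        OF of_nat_0_le_iff x_carrier v_eq[OF that]]
    by (simp only: z_step that \<sigma>_s)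
  have x_step: "x (int t + 1) = A *\<^sub>v x (int t) + B *\<^sub>v plant_input m dmax \<sigma> v (int t)"
    if "z t = switching_state n m dmax (past_delays dmax \<sigma> (int t)) (controller_data dmax x v (int t))" for t
  proof -
    have "A *\<^sub>v x (int t) + B *\<^sub>v plant_input m dmax \<sigma> v (int t) \<in> carrier_vec n"
      using assms(3) by (intro carrier_vecI) simp
    \<comment> \<open>Truncating twice follows the bracketing in \<open>step\<close>: first the
      transit blocks are cut off, then the output memory.\<close>
    moreover have "x (int t + 1) = vec_first (vec_first (z (Suc t)) (n + m * dmax)) n"
      by (intro eq_vecI) (auto simp: x_def vec_first_def nat_add_distrib)
    moreover have "stack_vecs (map (\<lambda>k. v (int t + 1 - int dmax + int k)) [0..<dmax])
        \<in> carrier_vec (m * dmax)"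
      by (intro stack_blocks_carrier v_carrier)
    ultimately show ?thesis
      unfolding step[OF that] by (simp add: vec_first_append)
  qed
  have z_eq: "z t = switching_state n m dmax (past_delays dmax \<sigma> (int t)) (controller_data dmax x v (int t))" for t
  proof (induction t)
    case 0
    then show ?case by (simp add: z0 h0 y0)
  next
    case (Suc t)
    then show ?case
      using step[OF Suc] x_step[OF Suc]
        switching_state_past[where x = x and t = "int (Suc t)", OF of_nat_0_le_iff x_carrier]
      by (simp only: of_nat_Suc add.commute[of 1])
  qed
  have "feedback_trajectory n m dmax D A B K \<sigma> x v"
    unfolding feedback_trajectory_def
    using \<sigma>_D v_carrier x_carrier x_step[OF z_eq] v_eq[OF z_eq] by (metis zero_le_imp_eq_int)
  then show thesis using h0 y0 \<sigma>_s z_eq by (rule that)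
qed

section \<open>Choice of the matrices and the representation\<close>

theorem theorem1:
  fixes n m dmax :: nat and D :: "nat set" and A B K :: "real mat"
  assumes "D \<subseteq> {0..dmax}"
    and "A \<in> carrier_mat n n"
    and "B \<in> carrier_mat n m"
    and "K \<in> carrier_mat m (n + m * dmax)"
  shows "\<exists>M :: nat \<Rightarrow> real mat.
    (\<forall>d\<in>D. M d \<in> carrier_mat (n + 2 * dmax * m) (n + 2 * dmax * m)) \<and>
    represented_by_switching n m dmax D A B K (n + 2 * dmax * m) M"
proof -
  let ?Y = "n + m * dmax" and ?N = "n + 2 * dmax * m"
  \<comment> \<open>The dimension counts the plant state, \<open>dmax\<close> remembered outputs and
    \<open>dmax\<close> transit sums, each of the latter two kinds of width
    \<open>m\<close>.\<close>
  have N: "?N = n + m * dmax + m * dmax" by simp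
  have "\<forall>d. \<exists>F \<in> carrier_mat ?N ?N. \<forall>z \<in> carrier_vec ?N. switching_step n m dmax A B K d z = F *\<^sub>v z"
    using matrix_map_switching_step[OF assms(2-4)] unfolding matrix_map_def N by blast
  then obtain M where M: "M d \<in> carrier_mat ?N ?N"
    and M_eq: "\<And>z. z \<in> carrier_vec ?N \<Longrightarrow> switching_step n m dmax A B K d z = M d *\<^sub>v z" for d
    by metis
  have "\<forall>h. \<exists>F \<in> carrier_mat ?N ?Y. \<forall>y \<in> carrier_vec ?Y. switching_state n m dmax h y = F *\<^sub>v y"
    using matrix_map_switching_state unfolding matrix_map_def N by blast
  then obtain E where E: "E h \<in> carrier_mat ?N ?Y"
    and E_eq: "\<And>y. y \<in> carrier_vec ?Y \<Longrightarrow> switching_state n m dmax h y = E h *\<^sub>v y" for h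
    by metis
  have "matrix_map ?N ?Y (\<lambda>z. vec_first z ?Y)"
    by (rule matrix_map_vec_first[OF matrix_map_id]) simp
  then obtain R :: "real mat" where R: "R \<in> carrier_mat ?Y ?N"
    and R_eq: "\<And>z. z \<in> carrier_vec ?N \<Longrightarrow> vec_first z ?Y = R *\<^sub>v z"
    unfolding matrix_map_def by blast
  have E_carrier: "E h *\<^sub>v y \<in> carrier_vec ?N" if "y \<in> carrier_vec ?Y" for h y
    using E that by (rule mult_mat_vec_carrier)
  \<comment> \<open>The readout keeps the first \<open>?Y\<close> coordinates, and the embedding
    puts its argument there unchanged, whatever the delays in \<open>h\<close>.\<close>
  have RE: "R * E h = 1\<^sub>m ?Y" for h
  proof (rule mat_eq_one)
    fix w :: "real vec" assume w: "w \<in> carrier_vec ?Y"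
    then have "R * E h *\<^sub>v w = vec_first (switching_state n m dmax h w) ?Y"
      using assoc_mult_mat_vec[OF R E w] by (simp add: R_eq E_eq E_carrier)
    then show "R * E h *\<^sub>v w = w" by (simp add: vec_first_switching_state[OF w])
  qed (use R E in auto)
  have forward: "switching_trajectory ?N D M (\<lambda>t. \<sigma> (int t))
      (\<lambda>t. E (past_delays dmax \<sigma> (int t)) *\<^sub>v controller_data dmax x v (int t))"
    if tr: "feedback_trajectory n m dmax D A B K \<sigma> x v" for \<sigma> x v
  proof -
    interpret delayed_outputs m dmax \<sigma> v
      using tr assms(1) by (rule feedback_trajectory_imp_delayed_outputs)
    have c: "controller_data dmax x v t \<in> carrier_vec ?Y" if "0 \<le> t" for t
      using tr that unfolding feedback_trajectory_def by (intro controller_data_carrier) auto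
    have "\<sigma> (int t) \<in> D" for t
      using tr unfolding feedback_trajectory_def by simp
    moreover have "E (past_delays dmax \<sigma> (int (Suc t))) *\<^sub>v controller_data dmax x v (int (Suc t)) =
        M (\<sigma> (int t)) *\<^sub>v (E (past_delays dmax \<sigma> (int t)) *\<^sub>v controller_data dmax x v (int t))" for t
    proof -
      have "int (Suc t) = int t + 1" by simp
      then show ?thesis
        using feedback_trajectory_step[OF tr assms(1), of "int t"] c[of "int t"] c[of "int t + 1"]
        by (simp only: E_eq M_eq E_carrier)
    qed
    ultimately show ?thesis
      unfolding switching_trajectory_def using c[of 0] by (simp add: E_carrier)
  qed
  have backward: "\<exists>\<sigma> x v. feedback_trajectory n m dmax D A B K \<sigma> x v \<and>
      past_delays dmax \<sigma> 0 = h \<and> controller_data dmax x v 0 = y \<and>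
      (\<forall>t. \<sigma> (int t) = s t \<and>
        z t = E (past_delays dmax \<sigma> (int t)) *\<^sub>v controller_data dmax x v (int t))"
    if h: "length h = dmax" "set h \<subseteq> D" and y: "y \<in> carrier_vec ?Y"
      and z: "switching_trajectory ?N D M s z" "z 0 = E h *\<^sub>v y" for h y s z
  proof -
    \<comment> \<open>\<open>M_eq\<close> holds only on the carrier, so dimensions come before
      replacing the matrices by \<open>switching_step\<close>.\<close>
    have z_carrier: "z t \<in> carrier_vec ?N" for t
      using z(1) M by (induction t) (auto simp: switching_trajectory_def intro: mult_mat_vec_carrier)
    have s: "s t \<in> D" and step: "z (Suc t) = switching_step n m dmax A B K (s t) (z t)" for t
      using z(1) by (auto simp: switching_trajectory_def M_eq[OF z_carrier])
    have "z 0 = switching_state n m dmax h y" using z(2) y by (simp add: E_eq)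
    from switching_run_realized[OF assms h y s this step] obtain \<sigma> x v where
      tr: "feedback_trajectory n m dmax D A B K \<sigma> x v"
      and init: "past_delays dmax \<sigma> 0 = h" "controller_data dmax x v 0 = y" "\<And>t. \<sigma> (int t) = s t"
      and z_eq: "\<And>t. z t = switching_state n m dmax (past_delays dmax \<sigma> (int t)) (controller_data dmax x v (int t))"
      by blast
    interpret delayed_outputs m dmax \<sigma> v
      using tr assms(1) by (rule feedback_trajectory_imp_delayed_outputs)
    have "controller_data dmax x v (int t) \<in> carrier_vec ?Y" for t
      using tr unfolding feedback_trajectory_def by (intro controller_data_carrier) auto
    then have "z t = E (past_delays dmax \<sigma> (int t)) *\<^sub>v controller_data dmax x v (int t)" for t
      using z_eq E_eq by simp
    with tr init show ?thesis by blast
  qed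
  have "represented_by_switching n m dmax D A B K ?N M"
    unfolding represented_by_switching_def
    using R E RE forward backward by (intro exI[of _ E] exI[of _ R] conjI allI impI) auto
  with M show ?thesis by blast
qed

end
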